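(* Let $T$ be an arbitrary theory (set of formulas of $\mathsf{SE}$) and $F$ a formula. If $T \vdash_{\mathsf{SE}} F$, then $T \Vdash F$.
   Context: Syntax of $\mathsf{SE}$. There are countably infinite sets of justification constants $\mathsf{JConst}=\{0,1,c_1,c_2,\dots\}$ (with two distinguished constants $0,1$) and justification variables $\mathsf{JVar}=\{x_1,x_2,\dots\}$. Terms: every constant and every variable is a term; if $s,t$ are terms then so are $s\cdot t$ and $s+t$. Formulas are built from $\bot$, atomic propositions $P$ from a countable set $\mathsf{Prop}$, implication $A\to B$, and $t:A$ for a term $t$ and formula $A$; $\neg,\wedge,\vee,\leftrightarrow$ are the usual abbreviations. $A[w/t]$ denotes the result of simultaneously replacing all occurrences of the variable $w$ in $A$ by the term $t$. Axioms of $\mathsf{SE}$ (for arbitrary formulas $A,B$ and variables $w,x,y,z$): (CL) all instances of propositional tautologies; (j) $x:(A\to B)\to(y:A\to x\cdot y:B)$; (j+) $x:A\wedge y:A\to(x+y):A$; (a+) $A[w/(x+y)+z]\to A[w/x+(y+z)]$; (c+) $A[w/x+y]\to A[w/y+x]$; (0+) $A[w/x+0]\leftrightarrow A[w/x]$; (am) $A[w/(x\cdot y)\cdot z]\leftrightarrow A[w/x\cdot(y\cdot z)]$; (a0) $A[w/x\cdot 0]\leftrightarrow A[w/0]$ and $A[w/0\cdot x]\leftrightarrow A[w/0]$; (a1) $A[w/x\cdot 1]\leftrightarrow A[w/x]$ and $A[w/1\cdot x]\leftrightarrow A[w/x]$; (dl) $A[w/x\cdot(y+z)]\leftrightarrow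 A[w/x\cdot y+x\cdot z]$; (dr) $A[w/(y+z)\cdot x]\leftrightarrow A[w/y\cdot x+z\cdot x]$. Rules: modus ponens (from $A$ and $A\to B$ infer $B$) and (jv): from $A$ infer $A[x/t]$ for any variable $x$ and term $t$. A theory is a set $T$ of formulas; $T\vdash_{\mathsf{SE}}F$ means $F$ has a derivation using axioms, members of $T$, and the two rules. Semantics. A semiring $K=(S,+,\cdot,0,1)$ satisfies: $+$ associative and commutative with neutral $0$; $\cdot$ associative with neutral $1$ (not necessarily commutative); both distributive laws; $a\cdot 0=0\cdot a=0$. An interpretation is a map $I:\mathsf{JConst}\to S$ with $I(0)=0$, $I(1)=1$; a valuation is a map $v:\mathsf{JVar}\to S$. For a term $t$, $t_I^v\in S$ is defined by $c_I^v=I(c)$, $x_I^v=v(x)$, $(s+t)_I^v=s_I^v+t_I^v$, $(s\cdot t)_I^v=s_I^v\cdot t_I^v$. $\mathsf{Fml}_S$ is the set of formulas built like ordinary formulas but with elements of $S$ in place of terms; $A_I^v\in\mathsf{Fml}_S$ replaces each term $t$ in $A$ by $t_I^v$. An evidence relation is $J\subseteq S\times \mathsf{Fml}_S$ such that $J(s,A\to B)$ and $J(t,A)$ imply $J(s\cdot t,B)$, and $J(s,A)$ and $J(t,A)$ imply $J(s+t,A)$. A semiring model is $M=(K,*,I,J)$ with $K$ a semiring, $*:\mathsf{Prop}\to\{\mathbb F,\mathbb T\}$, $I$ an interpretation, $J$ an evidence relation. Truth: $M,v\not\Vdash\bot$; $M,v\Vdash P$ iff $P^*=\mathbb T$; $M,v\Vdash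 A\to B$ iff $M,v\not\Vdash A$ or $M,v\Vdash B$; $M,v\Vdash s:A$ iff $J(s_I^v,A_I^v)$. $M\Vdash A$ iff $M,v\Vdash A$ for all valuations $v$; $M\Vdash T$ iff $M\Vdash A$ for all $A\in T$. $T\Vdash F$ iff every semiring model $M$ with $M\Vdash T$ satisfies $M\Vdash F$. *)

theory Defs
  imports "HOL-Algebra.Ring" "HOL-Library.Countable"
begin

datatype jconst = JZero | JOne | JC nat

datatype jvar = JV nat

datatype jterm =
    TConst jconst
  | TVar jvar
  | TTimes jterm jterm
  | TPlus jterm jterm

(* The type parameter 't is the type of justifying objects: with 't = jterm these are the
   formulas of SE, with 't = 's they are formulas over semiring elements. *)
datatype (justs: 't, props: 'p) fml =
    Bot
  | Atom 'p
  | Imp "('t, 'p) fml" "('t, 'p) fml"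
  | Just 't "('t, 'p) fml"

type_synonym 'p form = "(jterm, 'p) fml"

definition Neg :: "('t, 'p) fml \<Rightarrow> ('t, 'p) fml" where
  "Neg A = Imp A Bot"

definition Conj :: "('t, 'p) fml \<Rightarrow> ('t, 'p) fml \<Rightarrow> ('t, 'p) fml" where
  "Conj A B = Neg (Imp A (Neg B))"

definition Iff :: "('t, 'p) fml \<Rightarrow> ('t, 'p) fml \<Rightarrow> ('t, 'p) fml" where
  "Iff A B = Conj (Imp A B) (Imp B A)"

primrec tsubst :: "jvar \<Rightarrow> jterm \<Rightarrow> jterm \<Rightarrow> jterm" where
  "tsubst w t (TConst c) = TConst c"
| "tsubst w t (TVar x) = (if x = w then t else TVar x)"
| "tsubst w t (TTimes r s) = TTimes (tsubst w t r) (tsubst w t s)"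
| "tsubst w t (TPlus r s) = TPlus (tsubst w t r) (tsubst w t s)"

(* fsubst A w t is A[w/t] *)
definition fsubst :: "'p form \<Rightarrow> jvar \<Rightarrow> jterm \<Rightarrow> 'p form" where
  "fsubst A w t = map_fml (tsubst w t) id A"

datatype pform = PBot | PVar nat | PImp pform pform

primrec peval :: "(nat \<Rightarrow> bool) \<Rightarrow> pform \<Rightarrow> bool" where
  "peval e PBot = False"
| "peval e (PVar n) = e n"
| "peval e (PImp a b) = (peval e a \<longrightarrow> peval e b)"

definition tautology :: "pform \<Rightarrow> bool" where
  "tautology a \<longleftrightarrow> (\<forall>e. peval e a)"

primrec pinst :: "(nat \<Rightarrow> 'p form) \<Rightarrow> pform \<Rightarrow> 'p form" where
  "pinst \<sigma> PBot = Bot"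
| "pinst \<sigma> (PVar n) = \<sigma> n"
| "pinst \<sigma> (PImp a b) = Imp (pinst \<sigma> a) (pinst \<sigma> b)"

abbreviation "tzero \<equiv> TConst JZero"
abbreviation "tone \<equiv> TConst JOne"

(* The variables w, x, y, z need not be distinct. *)
inductive SE_axiom :: "'p form \<Rightarrow> bool" where
  CL: "tautology a \<Longrightarrow> SE_axiom (pinst \<sigma> a)"
| j: "SE_axiom (Imp (Just (TVar x) (Imp A B))
        (Imp (Just (TVar y) A) (Just (TTimes (TVar x) (TVar y)) B)))"
| j_plus: "SE_axiom (Imp (Conj (Just (TVar x) A) (Just (TVar y) A))
        (Just (TPlus (TVar x) (TVar y)) A))"
| a_plus: "SE_axiom (Imp (fsubst A w (TPlus (TPlus (TVar x) (TVar y)) (TVar z)))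
        (fsubst A w (TPlus (TVar x) (TPlus (TVar y) (TVar z)))))"
| c_plus: "SE_axiom (Imp (fsubst A w (TPlus (TVar x) (TVar y)))
        (fsubst A w (TPlus (TVar y) (TVar x))))"
| zero_plus: "SE_axiom (Iff (fsubst A w (TPlus (TVar x) tzero)) (fsubst A w (TVar x)))"
| am: "SE_axiom (Iff (fsubst A w (TTimes (TTimes (TVar x) (TVar y)) (TVar z)))
        (fsubst A w (TTimes (TVar x) (TTimes (TVar y) (TVar z)))))"
| a0_right: "SE_axiom (Iff (fsubst A w (TTimes (TVar x) tzero)) (fsubst A w tzero))"
| a0_left: "SE_axiom (Iff (fsubst A w (TTimes tzero (TVar x))) (fsubst A w tzero))"
| a1_right: "SE_axiom (Iff (fsubst A w (TTimes (TVar x) tone)) (fsubst A w (TVar x)))"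
| a1_left: "SE_axiom (Iff (fsubst A w (TTimes tone (TVar x))) (fsubst A w (TVar x)))"
| dl: "SE_axiom (Iff (fsubst A w (TTimes (TVar x) (TPlus (TVar y) (TVar z))))
        (fsubst A w (TPlus (TTimes (TVar x) (TVar y)) (TTimes (TVar x) (TVar z)))))"
| dr: "SE_axiom (Iff (fsubst A w (TTimes (TPlus (TVar y) (TVar z)) (TVar x)))
        (fsubst A w (TPlus (TTimes (TVar y) (TVar x)) (TTimes (TVar z) (TVar x)))))"

inductive SE_derives :: "'p form set \<Rightarrow> 'p form \<Rightarrow> bool" (infix "\<turnstile>\<^sub>S\<^sub>E" 50)
  for T :: "'p form set" where
  ax: "SE_axiom A \<Longrightarrow> T \<turnstile>\<^sub>S\<^sub>E A"
| hyp: "A \<in> T \<Longrightarrow> T \<turnstile>\<^sub>S\<^sub>E A"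
| mp: "T \<turnstile>\<^sub>S\<^sub>E A \<Longrightarrow> T \<turnstile>\<^sub>S\<^sub>E Imp A B \<Longrightarrow> T \<turnstile>\<^sub>S\<^sub>E B"
| jv: "T \<turnstile>\<^sub>S\<^sub>E A \<Longrightarrow> T \<turnstile>\<^sub>S\<^sub>E fsubst A x t"

definition Fml :: "'s set \<Rightarrow> ('s, 'p) fml set" where
  "Fml S = {A. justs A \<subseteq> S}"

definition interpretation_on :: "'s ring \<Rightarrow> (jconst \<Rightarrow> 's) \<Rightarrow> bool" where
  "interpretation_on K I \<longleftrightarrow>
     (\<forall>c. I c \<in> carrier K) \<and> I JZero = \<zero>\<^bsub>K\<^esub> \<and> I JOne = \<one>\<^bsub>K\<^esub>"

definition valuation_on :: "'s ring \<Rightarrow> (jvar \<Rightarrow> 's) \<Rightarrow> bool" where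
  "valuation_on K v \<longleftrightarrow> (\<forall>x. v x \<in> carrier K)"

primrec teval :: "'s ring \<Rightarrow> (jconst \<Rightarrow> 's) \<Rightarrow> (jvar \<Rightarrow> 's) \<Rightarrow> jterm \<Rightarrow> 's" where
  "teval K I v (TConst c) = I c"
| "teval K I v (TVar x) = v x"
| "teval K I v (TTimes s t) = teval K I v s \<otimes>\<^bsub>K\<^esub> teval K I v t"
| "teval K I v (TPlus s t) = teval K I v s \<oplus>\<^bsub>K\<^esub> teval K I v t"

definition feval :: "'s ring \<Rightarrow> (jconst \<Rightarrow> 's) \<Rightarrow> (jvar \<Rightarrow> 's) \<Rightarrow> 'p form \<Rightarrow> ('s, 'p) fml" where
  "feval K I v A = map_fml (teval K I v) id A"

definition evidence_relation :: "'s ring \<Rightarrow> ('s \<times> ('s, 'p) fml) set \<Rightarrow> bool" where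
  "evidence_relation K J \<longleftrightarrow>
     J \<subseteq> carrier K \<times> Fml (carrier K) \<and>
     (\<forall>s t A B. (s, Imp A B) \<in> J \<and> (t, A) \<in> J \<longrightarrow> (s \<otimes>\<^bsub>K\<^esub> t, B) \<in> J) \<and>
     (\<forall>s t A. (s, A) \<in> J \<and> (t, A) \<in> J \<longrightarrow> (s \<oplus>\<^bsub>K\<^esub> t, A) \<in> J)"

record ('s, 'p) smodel =
  sring :: "'s ring"
  pval :: "'p \<Rightarrow> bool"
  interp :: "jconst \<Rightarrow> 's"
  evid :: "('s \<times> ('s, 'p) fml) set"

definition semiring_model :: "('s, 'p) smodel \<Rightarrow> bool" where
  "semiring_model M \<longleftrightarrow>
     semiring (sring M) \<and> interpretation_on (sring M) (interp M) \<and>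
     evidence_relation (sring M) (evid M)"

primrec truth :: "('s, 'p) smodel \<Rightarrow> (jvar \<Rightarrow> 's) \<Rightarrow> 'p form \<Rightarrow> bool" where
  "truth M v Bot = False"
| "truth M v (Atom P) = pval M P"
| "truth M v (Imp A B) = (\<not> truth M v A \<or> truth M v B)"
| "truth M v (Just s A) =
     ((teval (sring M) (interp M) v s, feval (sring M) (interp M) v A) \<in> evid M)"

definition valid_in :: "('s, 'p) smodel \<Rightarrow> 'p form \<Rightarrow> bool" where
  "valid_in M A \<longleftrightarrow> (\<forall>v. valuation_on (sring M) v \<longrightarrow> truth M v A)"

(* The consequence relation restricted to models whose carrier is a subset of the type 's.
   A definition cannot quantify over types; consequence over all semiring models is this
   statement for every type 's, i.e. with 's a free type variable of a theorem. *)
definition SE_entails :: "'s itself \<Rightarrow> 'p form set \<Rightarrow> 'p form \<Rightarrow> bool" where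
  "SE_entails (_ :: 's itself) T F \<longleftrightarrow>
     (\<forall>M :: ('s, 'p) smodel.
        semiring_model M \<and> (\<forall>A\<in>T. valid_in M A) \<longrightarrow> valid_in M F)"

end

theory Submission
  imports Defs
begin

text \<open>
  Substituting a term for a variable amounts to updating the valuation at that variable. Hence the
  truth of \<open>A[w/t]\<close> depends on \<open>t\<close> only through its value, so each semiring law validates the
  corresponding substitution axiom, and validity under all valuations is preserved by the rule (jv).
\<close>

lemma teval_tsubst:
  "teval K I v (tsubst w t s) = teval K I (v(w := teval K I v t)) s"
  by (induction s) auto

lemma feval_fsubst:
  "feval K I v (fsubst A w t) = feval K I (v(w := teval K I v t)) A"
  unfolding feval_def fsubst_def
  by (simp add: fml.map_comp comp_def teval_tsubst id_def)

lemma truth_fsubst: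
  "truth M v (fsubst A w t) = truth M (v(w := teval (sring M) (interp M) v t)) A"
proof (induction A)
  case (Just s A)
  have "fsubst (Just s A) w t = Just (tsubst w t s) (fsubst A w t)"
    by (simp add: fsubst_def)
  \<comment> \<open>Truth of a justification formula is membership of its evaluated pair in the
    evidence relation, so it suffices that both components evaluate alike.\<close>
  then show ?case
    by (simp add: teval_tsubst feval_fsubst fun_upd_def)
qed (simp_all add: fsubst_def)

lemma truth_Conj [simp]: "truth M v (Conj A B) \<longleftrightarrow> truth M v A \<and> truth M v B"
  by (simp add: Conj_def Neg_def)

lemma truth_Iff [simp]: "truth M v (Iff A B) \<longleftrightarrow> (truth M v A \<longleftrightarrow> truth M v B)"
  by (auto simp: Iff_def)

text \<open>At a fixed valuation, truth commutes with implication, so the truth values of the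
  instances act as a propositional assignment to the letters.\<close>

lemma truth_pinst: "truth M v (pinst \<sigma> a) = peval (\<lambda>n. truth M v (\<sigma> n)) a"
  by (induction a) auto

text \<open>Ensures that the updated valuation in rule (jv) still takes values in the
  carrier.\<close>

lemma teval_closed:
  assumes "semiring K" "interpretation_on K I" "valuation_on K v"
  shows "teval K I v t \<in> carrier K"
proof -
  interpret semiring K by fact
  show ?thesis
    using assms(2,3) by (induction t) (auto simp: interpretation_on_def valuation_on_def)
qed

lemma truth_SE_axiom:
  assumes M: "semiring_model M" and v: "valuation_on (sring M) v" and A: "SE_axiom A"
  shows "truth M v A"
proof -
  interpret semiring "sring M"
    using M by (simp add: semiring_model_def)
  have v_closed: "v x \<in> carrier (sring M)" for x
    using v by (simp add: valuation_on_def)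
  have I: "interp M JZero = \<zero>\<^bsub>sring M\<^esub>" "interp M JOne = \<one>\<^bsub>sring M\<^esub>"
    using M by (simp_all add: semiring_model_def interpretation_on_def)
  have J: "evidence_relation (sring M) (evid M)"
    using M by (simp add: semiring_model_def)
  from A show ?thesis
  proof cases
    case (CL a \<sigma>)
    then show ?thesis by (simp add: truth_pinst tautology_def)
  next
    case (j x A B y)
    \<comment> \<open>Evaluation commutes with \<open>Imp\<close>, so closure of the evidence
      relation under application applies to the evaluated formulas.\<close>
    then show ?thesis using J by (auto simp: evidence_relation_def feval_def)
  next
    case (j_plus x A y)
    then show ?thesis using J by (auto simp: evidence_relation_def)
  \<comment> \<open>In the substitution axioms both terms have the same value by the semiring laws,
    so the two updated valuations coincide.\<close>
  qed (simp_all add: truth_fsubst v_closed I a_ac m_assoc l_distr r_distr)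
qed

lemma valid_in_fsubst:
  assumes M: "semiring_model M" and A: "valid_in M A"
  shows "valid_in M (fsubst A x t)"
  unfolding valid_in_def
proof (intro allI impI)
  fix v
  assume v: "valuation_on (sring M) v"
  then have "teval (sring M) (interp M) v t \<in> carrier (sring M)"
    using M by (simp add: semiring_model_def teval_closed)
  with v have "valuation_on (sring M) (v(x := teval (sring M) (interp M) v t))"
    by (simp add: valuation_on_def)
  with A show "truth M v (fsubst A x t)"
    by (simp add: valid_in_def truth_fsubst)
qed

text \<open>The induction carries validity rather than truth at one valuation, because (jv) passes
  to a different valuation.\<close>

lemma SE_derives_valid_in:
  assumes "T \<turnstile>\<^sub>S\<^sub>E F" and M: "semiring_model M" and "\<forall>A\<in>T. valid_in M A"
  shows "valid_in M F"
  using assms(1)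
proof induction
  case (ax A)
  then show ?case using M by (simp add: valid_in_def truth_SE_axiom)
next
  case (hyp A)
  then show ?case using assms(3) by simp
next
  case (mp A B)
  then show ?case by (simp add: valid_in_def)
next
  case (jv A x t)
  then show ?case using M by (simp add: valid_in_fsubst)
qed

theorem mainTheorem1:
  fixes T :: "('p::countable) form set" and F :: "'p form"
  assumes "T \<turnstile>\<^sub>S\<^sub>E F"
  shows "SE_entails TYPE('s) T F"
  using assms by (auto simp: SE_entails_def intro: SE_derives_valid_in)

end
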